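(* Let $n\ge 2$ be an integer, let $a\in(0,1)$, and let $p(z)=(z-a)\prod_{k=1}^{n-1}(z-z_k)$, where $z_1,\dots,z_{n-1}\in\mathbb{C}$ satisfy $|z_k|\le 1$ for $k=1,\dots,n-1$. Write $p'(z)=n\prod_{j=1}^{n-1}(z-\zeta_j)$ and $\rho_j=|a-\zeta_j|$ for $j=1,\dots,n-1$, with the critical points labelled so that $\rho_1\le\rho_2\le\dots\le\rho_{n-1}$. Let $\lambda$ be a real number. If $$1-(1-|p(0)|)^{\frac1n}\le\lambda\le\sin\left(\frac{\pi}{n}\right),\qquad \lambda<a,\qquad \rho_1\ge 1,$$ then there exists a critical point $\zeta_0=a+\rho_0e^{i\theta_0}$ of $p$ (i.e. $\zeta_0\in\{\zeta_1,\dots,\zeta_{n-1}\}$, with $\rho_0=|\zeta_0-a|$ and $\theta_0\in\mathbb{R}$) such that $$\Re\,\zeta_0\ \ge\ \frac12\left(a-\frac{\lambda(\lambda+2)}{a}\right).$$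
   Context: A critical point of a polynomial $p$ is a zero of its derivative $p'$. $\Re$ denotes the real part. The zeros $z_k$ and the critical points $\zeta_j$ are complex numbers listed with multiplicity. *)

theory Defs
  imports Complex_Main "HOL-Computational_Algebra.Polynomial"
begin

end

theory Submission
  imports Defs "HOL-Analysis.Analysis" "HOL-Computational_Algebra.Fundamental_Theorem_Algebra"
begin

text \<open>
  The idea is to find a point \<open>w\<close> near \<open>a\<close> at which \<open>p\<close> takes the same value as at \<open>0\<close>, and then
  to use that \<open>p\<close> must have a critical point on either side of the perpendicular bisector of
  \<open>0\<close> and \<open>w\<close>.

  Since every critical point has distance at least \<open>1\<close> from \<open>a\<close>, the factorisation of \<open>p'\<close> gives
  \<open>\<bar>p'(z)\<bar> \<ge> n (1 - \<bar>z - a\<bar>)^(n - 1)\<close> in the unit disc about \<open>a\<close>. So a curve that starts at \<open>a\<close>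
  and leaves the disc of radius \<open>\<lambda>\<close> has an image of length at least
  \<open>1 - (1 - \<lambda>)^n \<ge> \<bar>p(0)\<bar> = \<bar>p(0) - p(a)\<bar>\<close>. Lifting the segment from \<open>p(a) = 0\<close> to \<open>p(0)\<close> would
  therefore end at some \<open>w\<close> with \<open>\<bar>w - a\<bar> \<le> \<lambda>\<close> and \<open>p(w) = p(0)\<close>; here \<open>w \<noteq> 0\<close> because
  \<open>\<lambda> < a\<close>. Instead of lifting curves, the proof of \<open>preimage_in_cball\<close> minimises a function that
  adds to the distance of \<open>p(z)\<close> from the target a multiple of the length bound at \<open>z\<close>.

  By \<open>critical_point_bisector\<close>, a form of the Grace-Heawood theorem, some critical point \<open>\<zeta>\<close> is at
  least as close to \<open>w\<close> as to \<open>0\<close>, and then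
  \<open>\<bar>\<zeta> - a\<bar> \<le> \<bar>\<zeta> - w\<bar> + \<bar>w - a\<bar> \<le> \<bar>\<zeta>\<bar> + \<lambda>\<close>. Squaring, and using \<open>\<bar>\<zeta>\<bar> \<le> 1\<close> from the
  Gauss-Lucas theorem, turns this into \<open>a\<^sup>2 - 2 a Re \<zeta> \<le> \<lambda>\<^sup>2 + 2 \<lambda>\<close>, which is the claim.

  The bisector statement is Grace's apolarity theorem for a half-plane, applied to the functional
  \<open>B \<mapsto> \<integral> B\<close> over the segment from \<open>u\<close> to \<open>v\<close>, which sends \<open>p'\<close> to \<open>p(v) - p(u) = 0\<close>. Grace's
  theorem in turn follows from Laguerre's theorem on polar derivatives, used once for each zero.
\<close>

section \<open>Logarithmic derivatives and the Gauss-Lucas theorem\<close>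

lemma poly_pderiv_prod_linear:
  fixes r :: "'a \<Rightarrow> complex"
  assumes "finite S" "\<And>i. i \<in> S \<Longrightarrow> z \<noteq> r i"
  shows "poly (pderiv (\<Prod>i\<in>S. [:- r i, 1:])) z
           = poly (\<Prod>i\<in>S. [:- r i, 1:]) z * (\<Sum>i\<in>S. 1 / (z - r i))"
  using assms
proof (induction S rule: finite_induct)
  case (insert j S)
  have "z - r j \<noteq> 0" using insert.prems by auto
  define P where "P = (\<Prod>i\<in>S. [:- r i, 1:])"
  have "poly (pderiv P) z = poly P z * (\<Sum>i\<in>S. 1 / (z - r i))"
    unfolding P_def using insert by auto
  hence "poly (pderiv ([:- r j, 1:] * P)) z
           = poly ([:- r j, 1:] * P) z * (1 / (z - r j) + (\<Sum>i\<in>S. 1 / (z - r i)))"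
    using \<open>z - r j \<noteq> 0\<close> unfolding pderiv_mult poly_add poly_mult
    by (simp add: pderiv_pCons ring_distribs) (simp add: divide_simps, simp add: algebra_simps)
  moreover have "(\<Prod>i\<in>insert j S. [:- r i, 1:]) = [:- r j, 1:] * P"
    unfolding P_def by (rule prod.insert[OF insert.hyps])
  moreover have "(\<Sum>i\<in>insert j S. 1 / (z - r i)) = 1 / (z - r j) + (\<Sum>i\<in>S. 1 / (z - r i))"
    by (rule sum.insert[OF insert.hyps])
  ultimately show ?case by presburger
qed auto

text \<open>There are no zeros outside the disc, so the logarithmic derivative vanishes at a critical point
  there. But
  \<open>z / (z - r)\<close> has positive real part whenever \<open>\<bar>r\<bar> \<le> 1 < \<bar>z\<bar>\<close>, so these terms cannot cancel.\<close>

lemma gauss_lucas_unit_disc: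
  fixes r :: "'a \<Rightarrow> complex"
  assumes "finite S" "S \<noteq> {}" and r: "\<And>i. i \<in> S \<Longrightarrow> cmod (r i) \<le> 1"
    and crit: "poly (pderiv (\<Prod>i\<in>S. [:- r i, 1:])) z = 0"
  shows "cmod z \<le> 1"
proof (rule ccontr)
  assume "\<not> cmod z \<le> 1"
  hence z: "1 < cmod z" by simp
  have ne: "z \<noteq> r i" if "i \<in> S" for i using r[OF that] z by auto
  have "(\<Sum>i\<in>S. 1 / (z - r i)) = 0"
    using crit poly_pderiv_prod_linear[OF assms(1) ne] ne assms(1)
    by (auto simp: poly_prod)
  hence "(\<Sum>i\<in>S. z / (z - r i)) = 0"
    by (metis (no_types, lifting) divide_inverse mult_1 mult_zero_right sum.cong sum_distrib_left)
  hence "(\<Sum>i\<in>S. Re (z / (z - r i))) = 0" by (metis Re_sum zero_complex.simps(1))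
  moreover have "(\<Sum>i\<in>S. Re (z / (z - r i))) > 0"
  proof (rule sum_pos[OF assms(1,2)])
    fix i assume i: "i \<in> S"
    have "Re (z * cnj (r i)) \<le> cmod z * cmod (r i)"
      by (metis complex_Re_le_cmod complex_mod_cnj norm_mult)
    also have "\<dots> < cmod z * cmod z"
      using r[OF i] z by (intro mult_strict_left_mono) auto
    also have "\<dots> = Re (z * cnj z)" by (simp add: complex_norm_square[symmetric] power2_eq_square flip: of_real_mult)
    finally have "0 < Re (z * cnj (z - r i))" by (simp add: algebra_simps)
    moreover have "Re (z / (z - r i)) = Re (z * cnj (z - r i)) / (cmod (z - r i))\<^sup>2"
      by (subst complex_div_cnj) simp
    ultimately show "Re (z / (z - r i)) > 0" using ne[OF i] by simp
  qed
  ultimately show False by simp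
qed

section \<open>Laguerre's theorem for a half-plane\<close>

lemma coeff_prod_linear:
  fixes r :: "nat \<Rightarrow> complex"
  shows "coeff (\<Prod>i<n. [:- r i, 1:]) n = 1"
    and "coeff (\<Prod>i<Suc n. [:- r i, 1:]) n = - (\<Sum>i<Suc n. r i)"
proof -
  show *: "coeff (\<Prod>i<n. [:- r i, 1:]) n = 1" for n
  proof (induction n)
    case (Suc n)
    have "degree (\<Prod>i<n. [:- r i, 1:]) = n" by (simp add: degree_prod_sum_eq)
    hence "coeff (\<Prod>i<n. [:- r i, 1:]) (Suc n) = 0" by (simp add: coeff_eq_0)
    with Suc show ?case by simp
  qed simp
  show "coeff (\<Prod>i<Suc n. [:- r i, 1:]) n = - (\<Sum>i<Suc n. r i)"
  proof (induction n)
    case (Suc n)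
    show ?case
      by (subst prod.lessThan_Suc, subst mult.commute)
        (simp add: Suc * del: prod.lessThan_Suc)
  qed simp
qed

text \<open>For \<open>z\<close> in the open left half-plane, \<open>g \<mapsto> 1 / (z - g)\<close> maps the closed right half-plane into a
  disc. This makes the right half-plane closed under the averages of reciprocals that occur in
  a logarithmic derivative, since discs are convex.\<close>

lemma Re_nonneg_iff_reciprocal_disc:
  fixes z g :: complex
  assumes "Re z < 0" "g \<noteq> z"
  shows "Re g \<ge> 0 \<longleftrightarrow> 1 / (z - g) \<in> cball (of_real (1 / (2 * Re z))) (- 1 / (2 * Re z))"
proof -
  define x y where "x = Re (z - g)" and "y = Im (z - g)"
  define D where "D = x\<^sup>2 + y\<^sup>2"
  define s where "s = Re z"
  have s: "s < 0" using assms by (simp add: s_def)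
  have D: "D > 0" using assms unfolding D_def x_def y_def
    by (metis cmod_power2 eq_iff_diff_eq_0 zero_less_norm_iff zero_less_power)
  have "Re (1 / (z - g)) = x / D" "Im (1 / (z - g)) = - y / D"
    by (simp_all add: Re_divide Im_divide x_def y_def D_def)
  hence "(dist (of_real (1 / (2 * s))) (1 / (z - g)))\<^sup>2 = (1 / (2 * s) - x / D)\<^sup>2 + (y / D)\<^sup>2"
    by (simp add: dist_norm cmod_power2)
  also have "\<dots> = 1 / (2 * s)\<^sup>2 - x / (s * D) + D / D\<^sup>2"
    using s D unfolding D_def by (simp add: power2_diff power_divide add_divide_distrib)
  also have "\<dots> = (- 1 / (2 * s))\<^sup>2 + (s - x) / (s * D)"
    using s D by (simp add: field_simps power2_eq_square)
  finally have eq: "(dist (of_real (1 / (2 * s))) (1 / (z - g)))\<^sup>2 = (- 1 / (2 * s))\<^sup>2 + (s - x) / (s * D)" .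
  have "1 / (z - g) \<in> cball (of_real (1 / (2 * s))) (- 1 / (2 * s))
     \<longleftrightarrow> (dist (of_real (1 / (2 * s))) (1 / (z - g)))\<^sup>2 \<le> (- 1 / (2 * s))\<^sup>2"
    using s unfolding mem_cball by (intro power_mono_iff[symmetric]) auto
  also have "\<dots> \<longleftrightarrow> (s - x) / (s * D) \<le> 0" unfolding eq by simp
  also have "\<dots> \<longleftrightarrow> s - x \<ge> 0"
    using mult_neg_pos[OF s D] by (auto simp: divide_le_0_iff)
  also have "s - x = Re g" by (simp add: s_def x_def)
  finally show ?thesis by (simp add: s_def)
qed

text \<open>The polynomial \<open>H\<close> is the polar derivative of \<open>G\<close> with pole \<open>\<zeta>\<close>. A zero \<open>z\<close> of \<open>H\<close> with
  \<open>G(z) \<noteq> 0\<close> makes \<open>1 / (z - \<zeta>)\<close> the average of \<open>1 / (z - r)\<close> over the zeros \<open>r\<close> of \<open>G\<close>; if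
  \<open>z\<close> lay in the left half-plane, the convexity of the disc above would force \<open>\<zeta>\<close> into the right
  half-plane with the \<open>r\<close>. The degree drops by exactly one because the next coefficient of \<open>H\<close> is
  a multiple of \<open>\<zeta>\<close> minus the mean of the zeros of \<open>G\<close>, and these are separated by the
  imaginary axis; exactness of the degree is what allows the step to be repeated.\<close>

lemma laguerre_half_plane:
  fixes G H :: "complex poly"
  assumes deg: "degree G = Suc d" and nz: "\<And>z. Re z < 0 \<Longrightarrow> poly G z \<noteq> 0" and \<zeta>: "Re \<zeta> < 0"
    and H: "H = smult (of_nat (Suc d)) G + [:\<zeta>, -1:] * pderiv G"
  shows "degree H = d" and "\<And>z. Re z < 0 \<Longrightarrow> poly H z \<noteq> 0"
proof -
  obtain r where "smult (lead_coeff G) (\<Prod>i<Suc d. [:- r i, 1:]) = G"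
    using complex_poly_decompose'[of G] deg by metis
  then obtain c where G: "G = smult c (\<Prod>i<Suc d. [:- r i, 1:])" and c: "c \<noteq> 0"
    using deg by (metis leading_coeff_0_iff degree_0 nat.distinct(1))
  have r: "Re (r i) \<ge> 0" if "i < Suc d" for i
  proof (rule ccontr)
    assume "\<not> Re (r i) \<ge> 0"
    moreover have "poly G (r i) = 0" using that by (auto simp: G poly_prod simp del: prod.lessThan_Suc)
    ultimately show False using nz[of "r i"] by auto
  qed
  have coeff_H: "coeff H i = (of_nat (Suc d) - of_nat i) * coeff G i + \<zeta> * of_nat (Suc i) * coeff G (Suc i)" for i
    by (cases i) (simp_all add: H coeff_pderiv algebra_simps)
  show "degree H = d"
  proof (rule antisym)
    show "degree H \<le> d"
    proof (rule degree_le, safe)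
      fix i assume "d < i"
      thus "coeff H i = 0" using deg by (cases "i = Suc d") (auto simp: coeff_H coeff_eq_0)
    qed
    have "coeff H d = c * (of_nat (Suc d) * \<zeta> - (\<Sum>i<Suc d. r i))"
      using coeff_prod_linear(1)[of r "Suc d"] coeff_prod_linear(2)[of r d]
      by (simp add: coeff_H G algebra_simps del: prod.lessThan_Suc sum.lessThan_Suc)
    moreover have "Re (of_nat (Suc d) * \<zeta> - (\<Sum>i<Suc d. r i)) < 0"
    proof -
      have "0 \<le> (\<Sum>i<Suc d. Re (r i))" using r by (intro sum_nonneg) auto
      moreover have "of_nat (Suc d) * Re \<zeta> < 0" using \<zeta> by (intro mult_pos_neg) auto
      ultimately show ?thesis by (simp del: sum.lessThan_Suc of_nat_Suc)
    qed
    ultimately have "coeff H d \<noteq> 0" using c by (metis less_irrefl mult_eq_0_iff zero_complex.simps(1))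
    thus "d \<le> degree H" by (rule le_degree)
  qed
  fix z :: complex assume z: "Re z < 0"
  show "poly H z \<noteq> 0"
  proof
    assume H0: "poly H z = 0"
    have ne: "r i \<noteq> z" if "i < Suc d" for i using r[OF that] z by auto
    define S where "S = (\<Sum>i<Suc d. 1 / (z - r i))"
    have "poly (pderiv G) z = poly G z * S"
      using poly_pderiv_prod_linear[of "{..<Suc d}" z r] ne
      by (auto simp: G pderiv_smult S_def simp del: prod.lessThan_Suc sum.lessThan_Suc)
    hence "poly G z * (of_nat (Suc d) + (\<zeta> - z) * S) = 0"
      using H0 by (simp add: H algebra_simps)
    hence "of_nat (Suc d) + (\<zeta> - z) * S = 0" using nz[OF z] by (simp del: of_nat_Suc)
    hence S: "of_nat (Suc d) = (z - \<zeta>) * S" by (simp add: algebra_simps del: of_nat_Suc)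
    hence "z \<noteq> \<zeta>" by (metis cancel_comm_monoid_add_class.diff_cancel mult_zero_left of_nat_eq_0_iff nat.distinct(1))
    have "(\<Sum>i<Suc d. (1 / real (Suc d)) *\<^sub>R (1 / (z - r i)))
        \<in> cball (of_real (1 / (2 * Re z))) (- 1 / (2 * Re z))"
    proof (rule convex_sum)
      fix i assume i: "i \<in> {..<Suc d}"
      show "1 / (z - r i) \<in> cball (of_real (1 / (2 * Re z))) (- 1 / (2 * Re z))"
        using Re_nonneg_iff_reciprocal_disc[OF z, of "r i"] r ne i by auto
    qed auto
    also have "(\<Sum>i<Suc d. (1 / real (Suc d)) *\<^sub>R (1 / (z - r i))) = (1 / real (Suc d)) *\<^sub>R S"
      unfolding S_def by (rule scaleR_right.sum[symmetric])
    also have "\<dots> = S / of_nat (Suc d)" by (simp add: scaleR_conv_of_real del: of_nat_Suc)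
    also have "\<dots> = 1 / (z - \<zeta>)" using S \<open>z \<noteq> \<zeta>\<close>
      by (metis divide_divide_eq_left' div_self eq_iff_diff_eq_0 mult.commute mult_eq_0_iff nat.distinct(1) of_nat_eq_0_iff)
    finally have "Re \<zeta> \<ge> 0" using Re_nonneg_iff_reciprocal_disc[OF z, of \<zeta>] \<open>z \<noteq> \<zeta>\<close> by auto
    with \<zeta> show False by simp
  qed
qed

section \<open>Grace's theorem for a half-plane\<close>

text \<open>
  For a linear functional \<open>J\<close> this is the polynomial \<open>z \<mapsto> J (A (X - z)^d)\<close> (see
  \<open>poly_polarization\<close> below). The recursion peels off one factor \<open>X - z\<close>, with \<open>z\<close> as the
  indeterminate of the result; it avoids polynomials in two variables.
\<close>

primrec polarization :: "(complex poly \<Rightarrow> complex) \<Rightarrow> nat \<Rightarrow> complex poly \<Rightarrow> complex poly" where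
  "polarization J 0 A = [:J A:]"
| "polarization J (Suc d) A = polarization J d (A * [:0, 1:]) - [:0, 1:] * polarization J d A"

context
  fixes J :: "complex poly \<Rightarrow> complex"
  assumes J_add: "\<And>A B. J (A + B) = J A + J B" and J_smult: "\<And>c A. J (smult c A) = c * J A"
begin

lemma functional_diff: "J (A - B) = J A - J B"
proof -
  have "J (A - B) = J (A + smult (-1) B)" by simp
  thus ?thesis by (simp only: J_add J_smult) simp
qed

lemma polarization_linear:
  "polarization J d (A * [:- \<zeta>, 1:]) = polarization J d (A * [:0, 1:]) - smult \<zeta> (polarization J d A)"
proof (induction d arbitrary: A)
  case 0
  have "A * [:- \<zeta>, 1:] = A * [:0, 1:] - smult \<zeta> A" by simp
  thus ?case by (simp only: polarization.simps functional_diff J_smult) simp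
next
  case (Suc d)
  have *: "A * [:- \<zeta>, 1:] * [:0, 1:] = A * [:0, 1:] * [:- \<zeta>, 1:]" by (simp add: ac_simps)
  show ?case unfolding polarization.simps * Suc by (simp add: algebra_simps smult_diff_right smult_add_right)
qed

lemma poly_polarization: "poly (polarization J d A) z = J (A * [:- z, 1:] ^ d)"
proof (induction d arbitrary: A)
  case (Suc d)
  have *: "A * [:- z, 1:] ^ Suc d = A * [:0, 1:] * [:- z, 1:] ^ d - smult z (A * [:- z, 1:] ^ d)"
  proof -
    have "A * [:- z, 1:] ^ Suc d = (A * [:-z, 1:] ^ d) * [:- z, 1:]" by (simp add: ac_simps)
    also have "\<dots> = (A * [:-z, 1:] ^ d) * [:0, 1:] - smult z (A * [:- z, 1:] ^ d)" by simp
    finally show ?thesis by (simp add: ac_simps)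
  qed
  show ?case unfolding * functional_diff J_smult using Suc by simp
qed simp

lemma degree_polarization: "degree (polarization J d A) \<le> d"
  and coeff_polarization: "coeff (polarization J d A) d = (- 1) ^ d * J A"
proof (induction d arbitrary: A)
  case (Suc d)
  { case 1
    show ?case using Suc(1)[of A] Suc(1)[of "A * [:0, 1:]"]
      by (auto intro!: degree_diff_le degree_pCons_le order.trans[OF degree_pCons_le])
  next
    case 2
    show ?case using Suc(1)[of "A * [:0, 1:]"] Suc(2)[of A] by (simp add: coeff_eq_0) }
qed auto

lemma pderiv_polarization:
  "pderiv (polarization J (Suc d) A) = smult (- of_nat (Suc d)) (polarization J d A)"
proof (induction d arbitrary: A)
  case 0
  show ?case by (simp add: pderiv_diff pderiv_mult pderiv_pCons)
next
  case (Suc d)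
  have "pderiv (polarization J (Suc (Suc d)) A) =
     pderiv (polarization J (Suc d) (A * [:0, 1:])) - polarization J (Suc d) A
       - [:0, 1:] * pderiv (polarization J (Suc d) A)"
    by (subst polarization.simps) (simp add: pderiv_diff pderiv_mult pderiv_pCons algebra_simps del: polarization.simps)
  also have "\<dots> = smult (- of_nat (Suc d)) (polarization J (Suc d) A) - polarization J (Suc d) A"
    unfolding Suc by (simp add: smult_diff_right algebra_simps)
  also have "\<dots> = smult (- of_nat (Suc (Suc d))) (polarization J (Suc d) A)"
    by (simp add: poly_eq_poly_eq_iff[symmetric] fun_eq_iff algebra_simps del: polarization.simps)
  finally show ?case .
qed

text \<open>Replacing one of the factors \<open>X - z\<close> by \<open>X - \<zeta>\<close> amounts to taking the polar derivative with
  pole \<open>\<zeta>\<close>, which is why Laguerre's theorem applies.\<close>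

lemma polarization_polar_derivative:
  "smult (of_nat (Suc d)) (polarization J d (A * [:- \<zeta>, 1:])) =
     smult (of_nat (Suc d)) (polarization J (Suc d) A) + [:\<zeta>, -1:] * pderiv (polarization J (Suc d) A)"
  unfolding pderiv_polarization polarization_linear
  by (simp add: poly_eq_poly_eq_iff[symmetric] fun_eq_iff algebra_simps)

lemma polarization_prod:
  assumes "finite S" "\<And>i. i \<in> S \<Longrightarrow> Re (\<zeta> i) < 0"
    and "degree (polarization J (card S + d) A) = card S + d"
    and "\<And>z. Re z < 0 \<Longrightarrow> poly (polarization J (card S + d) A) z \<noteq> 0"
  shows "degree (polarization J d (A * (\<Prod>i\<in>S. [:- \<zeta> i, 1:]))) = d \<and>
    (\<forall>z. Re z < 0 \<longrightarrow> poly (polarization J d (A * (\<Prod>i\<in>S. [:- \<zeta> i, 1:]))) z \<noteq> 0)"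
  using assms
proof (induction S arbitrary: A rule: finite_induct)
  case (insert j S)
  define m where "m = card S + d"
  define H where "H = smult (of_nat (Suc m)) (polarization J m (A * [:- \<zeta> j, 1:]))"
  have *: "card (insert j S) + d = Suc m" using insert by (simp add: m_def)
  note lag = laguerre_half_plane[of "polarization J (Suc m) A" m "\<zeta> j" H,
      OF insert.prems(2)[unfolded *] insert.prems(3)[unfolded *] insert.prems(1)[OF insertI1]
         H_def[unfolded polarization_polar_derivative]]
  have "degree (polarization J d (A * [:- \<zeta> j, 1:] * (\<Prod>i\<in>S. [:- \<zeta> i, 1:]))) = d \<and>
    (\<forall>z. Re z < 0 \<longrightarrow> poly (polarization J d (A * [:- \<zeta> j, 1:] * (\<Prod>i\<in>S. [:- \<zeta> i, 1:]))) z \<noteq> 0)"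
  proof (rule insert.IH)
    show "degree (polarization J (card S + d) (A * [:- \<zeta> j, 1:])) = card S + d"
      using lag(1) by (simp add: H_def m_def del: of_nat_Suc)
    show "poly (polarization J (card S + d) (A * [:- \<zeta> j, 1:])) z \<noteq> 0" if "Re z < 0" for z
      using lag(2)[of z] that by (simp add: H_def m_def del: of_nat_Suc)
  qed (use insert in auto)
  moreover have "A * (\<Prod>i\<in>insert j S. [:- \<zeta> i, 1:]) = A * [:- \<zeta> j, 1:] * (\<Prod>i\<in>S. [:- \<zeta> i, 1:])"
    by (simp only: prod.insert[OF insert.hyps] mult.assoc)
  ultimately show ?case by metis
qed simp

text \<open>The condition \<open>J 1 \<noteq> 0\<close> gives \<open>z \<mapsto> J ((X - z)^m)\<close>, with \<open>m\<close> the cardinality of \<open>S\<close>, the exact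
  degree \<open>m\<close>, since its leading coefficient is \<open>\<plusminus>J 1\<close>. The factors \<open>X - z\<close> are replaced
  one at a time by the \<open>X - \<zeta> i\<close>, each time by a polar derivative, and the constant that remains is
  still non-zero.\<close>

lemma grace_half_plane:
  assumes "finite S" "\<And>i. i \<in> S \<Longrightarrow> Re (\<zeta> i) < 0"
    and "J 1 \<noteq> 0" and "\<And>z. Re z < 0 \<Longrightarrow> J ([:- z, 1:] ^ card S) \<noteq> 0"
  shows "J (\<Prod>i\<in>S. [:- \<zeta> i, 1:]) \<noteq> 0"
proof -
  have "coeff (polarization J (card S) 1) (card S) \<noteq> 0" using assms(3) by (simp add: coeff_polarization)
  hence "degree (polarization J (card S) 1) = card S"
    using degree_polarization le_degree by (metis antisym)
  with polarization_prod[of S \<zeta> 0 1] assms 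
  have "\<forall>z. Re z < 0 \<longrightarrow> poly (polarization J 0 (\<Prod>i\<in>S. [:- \<zeta> i, 1:])) z \<noteq> 0"
    by (simp add: poly_polarization)
  from this[rule_format, of "-1"] show ?thesis by simp
qed

end

section \<open>Critical points and perpendicular bisectors\<close>

lemma integral_pderiv_segment:
  fixes p :: "complex poly"
  shows "integral {-1..1} (\<lambda>t. h * poly (pderiv p) (m + of_real t * h)) = poly p (m + h) - poly p (m - h)"
proof -
  have "((\<lambda>t. h * poly (pderiv p) (m + of_real t * h)) has_integral
      (poly p (m + of_real 1 * h) - poly p (m + of_real (-1) * h))) {-1..1}"
  proof (rule fundamental_theorem_of_calculus)
    fix t :: real
    have "((\<lambda>x. m + x * h) has_field_derivative h) (at (of_real t))"
      by (auto intro!: derivative_eq_intros)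
    from DERIV_chain2[OF poly_DERIV this]
    have "((\<lambda>x. poly p (m + x * h)) has_field_derivative h * poly (pderiv p) (m + of_real t * h)) (at (of_real t))"
      by (simp add: mult.commute)
    from has_vector_derivative_real_field[OF this]
    show "((\<lambda>t. poly p (m + of_real t * h)) has_vector_derivative h * poly (pderiv p) (m + of_real t * h)) (at t within {-1..1})"
      by simp
  qed simp
  from integral_unique[OF this] show ?thesis by (simp del: integral_mult_right)
qed

text \<open>The segment from \<open>u\<close> to \<open>v\<close> is moved to \<open>[-1, 1]\<close>, so that the perpendicular bisector becomes
  the imaginary axis. For \<open>J B = \<integral>B\<close> over \<open>[-1, 1]\<close>, the number \<open>J ((X - z)^m)\<close> is a multiple
  of \<open>(1 - z)^(m + 1) - (- 1 - z)^(m + 1)\<close>, whose zeros are equidistant from \<open>1\<close> and \<open>- 1\<close> and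
  hence lie on that axis.\<close>

lemma critical_point_bisector:
  fixes p :: "complex poly" and u v :: complex
  assumes "finite S" and p': "pderiv p = smult c (\<Prod>i\<in>S. [:- \<zeta> i, 1:])" "c \<noteq> 0"
    and "u \<noteq> v" "poly p u = poly p v"
  shows "\<exists>i\<in>S. cmod (\<zeta> i - v) \<le> cmod (\<zeta> i - u)"
proof (rule ccontr)
  assume "\<not> ?thesis"
  hence far: "cmod (\<zeta> i - u) < cmod (\<zeta> i - v)" if "i \<in> S" for i using that by force
  define m h where "m = (u + v) / 2" and "h = (v - u) / 2"
  have h: "h \<noteq> 0" using assms by (simp add: h_def)
  have uv: "u = m - h" "v = m + h" by (simp_all add: m_def h_def field_simps)
  define \<xi> where "\<xi> i = (\<zeta> i - m) / h" for i
  define J where "J B = integral {-1..1::real} (\<lambda>t. poly B (of_real t))" for B :: "complex poly"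
  have int: "(\<lambda>t. poly B (of_real t)) integrable_on {-1..1::real}" for B :: "complex poly"
    by (intro integrable_continuous_real continuous_intros)
  have J_FTC: "J (pderiv B) = poly B 1 - poly B (-1)" for B
    using integral_pderiv_segment[of 1 B 0] by (simp add: J_def)
  have "J (\<Prod>i\<in>S. [:- \<xi> i, 1:]) \<noteq> 0"
  proof (rule grace_half_plane)
    show "J (A + B) = J A + J B" for A B by (simp add: J_def integral_add int)
    show J_smult: "J (smult k A) = k * J A" for k A by (simp add: J_def)
    show "Re (\<xi> i) < 0" if "i \<in> S" for i
    proof -
      have "cmod (h * (\<xi> i + 1)) < cmod (h * (\<xi> i - 1))"
      proof -
        have "h * (\<xi> i + 1) = \<zeta> i - u" "h * (\<xi> i - 1) = \<zeta> i - v"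
          using h by (simp_all add: \<xi>_def uv field_simps)
        thus ?thesis using far[OF that] by simp
      qed
      hence "cmod (\<xi> i + 1) < cmod (\<xi> i - 1)" using h by (simp add: norm_mult)
      thus ?thesis by (simp add: norm_complex_def power2_eq_square algebra_simps)
    qed
    show "J 1 \<noteq> 0" using J_FTC[of "[:0, 1:]"] by (simp add: pderiv_pCons one_pCons)
    show "J ([:- z, 1:] ^ card S) \<noteq> 0" if "Re z < 0" for z
    proof
      assume "J ([:- z, 1:] ^ card S) = 0"
      hence "J (pderiv ([:- z, 1:] ^ Suc (card S))) = 0"
        by (simp only: pderiv_power_Suc) (simp add: J_smult pderiv_pCons del: of_nat_Suc)
      hence "(1 - z) ^ Suc (card S) = (- 1 - z) ^ Suc (card S)"
        unfolding J_FTC by (simp only: poly_power) (simp add: algebra_simps del: power_Suc)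
      hence "cmod (1 - z) = cmod (- 1 - z)"
        by (metis norm_power power_eq_imp_eq_base norm_ge_zero zero_less_Suc)
      thus False using that by (simp add: norm_complex_def power2_eq_square algebra_simps)
    qed
  qed (use assms in auto)
  moreover have "h * poly (pderiv p) (m + of_real t * h)
      = (h * c * h ^ card S) * poly (\<Prod>i\<in>S. [:- \<xi> i, 1:]) (of_real t)" for t
  proof -
    have "(\<Prod>i\<in>S. m + of_real t * h - \<zeta> i) = (\<Prod>i\<in>S. h * (of_real t - \<xi> i))"
      using h by (intro prod.cong) (auto simp: \<xi>_def field_simps)
    also have "\<dots> = h ^ card S * (\<Prod>i\<in>S. of_real t - \<xi> i)" by (simp add: prod.distrib)
    finally show ?thesis by (simp add: p' poly_prod)
  qed
  hence "(h * c * h ^ card S) * J (\<Prod>i\<in>S. [:- \<xi> i, 1:]) = 0"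
    using integral_pderiv_segment[of h p m] assms(5) unfolding uv
    by (simp only: J_def integral_mult_right[symmetric]) simp
  ultimately show False using h p' by simp
qed



section \<open>Values taken near a point of large derivative\<close>

lemma power_tangent:
  fixes x y :: real
  assumes "0 \<le> x" "0 < y"
  shows "y ^ n + of_nat n * y ^ (n - 1) * (x - y) \<le> x ^ n"
proof (cases n)
  case (Suc m)
  have "1 + of_nat n * (x / y - 1) \<le> (1 + (x / y - 1)) ^ n"
    by (rule Bernoulli_inequality) (use assms in auto)
  hence "(1 + of_nat n * (x / y - 1)) * y ^ n \<le> (x / y) ^ n * y ^ n"
    using assms by (intro mult_right_mono) auto
  also have "(x / y) ^ n * y ^ n = x ^ n" using assms by (simp add: power_divide)
  also have "(1 + of_nat n * (x / y - 1)) * y ^ n = y ^ n + of_nat n * y ^ (n - 1) * (x - y)"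
    using assms by (simp add: Suc field_simps)
  finally show ?thesis .
qed simp

text \<open>The term \<open>1 - (1 - \<bar>z - a\<bar>)^n\<close> integrates the lower bound for \<open>\<bar>p'\<bar>\<close> along a radius. The function
  \<open>F\<close> adds to \<open>\<bar>p(z) - c\<bar>\<close> a multiple \<open>k < 1\<close> of it. A minimum \<open>w\<close> of \<open>F\<close> on the disc is not on
  the boundary, where \<open>F\<close> exceeds \<open>F(a)\<close>. If \<open>p(w) \<noteq> c\<close>, a small Newton step from \<open>w\<close> decreases
  \<open>\<bar>p(z) - c\<bar>\<close> at the rate \<open>\<bar>p'(w)\<bar>\<close>, whereas the other term grows at most at \<open>k\<close> times that
  rate, so that \<open>F\<close> would become smaller.\<close>

lemma preimage_in_ball:
  fixes p :: "complex poly" and a c :: complex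
  assumes p': "\<And>z. cmod (z - a) < 1 \<Longrightarrow> of_nat n * (1 - cmod (z - a)) ^ (n - 1) \<le> cmod (poly (pderiv p) z)"
    and "n > 0" and r: "0 \<le> r" "r < 1" and c: "cmod (poly p a - c) < 1 - (1 - r) ^ n"
  shows "\<exists>z. cmod (z - a) \<le> r \<and> poly p z = c"
proof -
  define L where "L = 1 - (1 - r) ^ n"
  have L: "L > 0" using c norm_ge_zero[of "poly p a - c"] unfolding L_def by linarith
  obtain k where "cmod (poly p a - c) / L < k" and k: "k < 1"
    using dense[of "cmod (poly p a - c) / L" 1] c L by (auto simp: L_def)
  hence kL: "cmod (poly p a - c) < k * L" using L by (simp add: field_simps)
  have k0: "k > 0" using kL L norm_ge_zero[of "poly p a - c"] by (smt (verit) zero_less_mult_pos2)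
  define F where "F z = cmod (poly p z - c) + k * (1 - (1 - cmod (z - a)) ^ n)" for z
  have "\<exists>w\<in>cball a r. \<forall>z\<in>cball a r. F w \<le> F z"
    unfolding F_def by (intro continuous_attains_inf continuous_intros) (use r in auto)
  then obtain w where w: "cmod (w - a) \<le> r" and min: "\<And>z. cmod (z - a) \<le> r \<Longrightarrow> F w \<le> F z"
    by (force simp: dist_norm norm_minus_commute)
  have Fa: "F a = cmod (poly p a - c)" using \<open>n > 0\<close> by (simp add: F_def)
  have w_less: "cmod (w - a) < r"
  proof (rule ccontr)
    assume "\<not> cmod (w - a) < r"
    hence "k * L \<le> F w" using w by (simp add: F_def L_def)
    moreover have "F w \<le> F a" using r by (intro min) auto
    ultimately show False using Fa kL by simp
  qed
  define D where "D = poly (pderiv p) w"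
  define y where "y = 1 - cmod (w - a)"
  have y: "0 < y" using w r by (simp add: y_def)
  have D: "of_nat n * y ^ (n - 1) \<le> cmod D" using p'[of w] w r by (simp add: D_def y_def)
  have "of_nat n * y ^ (n - 1) > 0" using y \<open>n > 0\<close> by simp
  hence "D \<noteq> 0" using D by auto
  have "poly p w = c"
  proof (rule ccontr)
    assume "poly p w \<noteq> c"
    define E where "E = poly p w - c"
    have E: "cmod E > 0" using \<open>poly p w \<noteq> c\<close> by (simp add: E_def)
    \<comment> \<open>the Newton step towards \<open>c\<close>, to be shortened by a factor \<open>t\<close>\<close>
    define v where "v = - E / D"
    have v: "cmod v > 0" using E \<open>D \<noteq> 0\<close> by (simp add: v_def norm_divide)
    \<comment> \<open>chosen so that the linearisation error uses up only half of the gain \<open>(1 - k) t \<bar>E\<bar>\<close>\<close>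
    define \<epsilon> where "\<epsilon> = (1 - k) * cmod E / (2 * cmod v)"
    have \<epsilon>: "\<epsilon> > 0" using E v k by (simp add: \<epsilon>_def)
    have "((\<lambda>z. poly p z) has_derivative (\<lambda>h. D * h)) (at w)"
      using poly_DERIV[of p w] by (simp add: has_field_derivative_def D_def)
    then obtain \<delta> where \<delta>: "\<delta> > 0"
      and lin: "\<And>z. cmod (z - w) < \<delta> \<Longrightarrow> cmod (poly p z - poly p w - D * (z - w)) \<le> \<epsilon> * cmod (z - w)"
      using \<epsilon> unfolding has_derivative_at_alt by blast
    define t where "t = min 1 (min (\<delta> / (2 * cmod v)) ((r - cmod (w - a)) / cmod v))"
    have t: "t > 0" "t \<le> 1" "t \<le> \<delta> / (2 * cmod v)" "t \<le> (r - cmod (w - a)) / cmod v"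
      using \<delta> v w_less by (auto simp: t_def)
    have t_v: "t * cmod v < \<delta>" "t * cmod v \<le> r - cmod (w - a)"
      using t(3,4) v \<delta> by (auto simp: field_simps)
    define z where "z = w + of_real t * v"
    have zw: "cmod (z - w) = t * cmod v" using t by (simp add: z_def norm_mult)
    have za: "cmod (z - a) \<le> cmod (w - a) + t * cmod v"
      using norm_triangle_ineq[of "z - w" "w - a"] zw by simp
    have zr: "cmod (z - a) \<le> r" using za t_v by linarith
    have "D * (z - w) = - of_real t * E" using \<open>D \<noteq> 0\<close> by (simp add: z_def v_def)
    hence "poly p z - c = of_real (1 - t) * E + (poly p z - poly p w - D * (z - w))"
      by (simp add: E_def algebra_simps)
    hence "cmod (poly p z - c) \<le> (1 - t) * cmod E + \<epsilon> * (t * cmod v)"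
      using lin[of z] zw t_v t(2)
      by (smt (verit) norm_triangle_ineq norm_mult norm_of_real)
    also have "\<epsilon> * (t * cmod v) = t * ((1 - k) * cmod E / 2)" using v by (simp add: \<epsilon>_def)
    finally have 1: "cmod (poly p z - c) \<le> (1 - t) * cmod E + t * ((1 - k) * cmod E / 2)" .
    \<comment> \<open>by concavity, the first-order bound for the length term holds without an error\<close>
    have "y ^ n - (1 - cmod (z - a)) ^ n \<le> of_nat n * y ^ (n - 1) * (y - (1 - cmod (z - a)))"
      using power_tangent[of "1 - cmod (z - a)" y n] y zr r by (simp add: algebra_simps)
    also have "\<dots> \<le> of_nat n * y ^ (n - 1) * (t * cmod v)"
      using za y by (intro mult_left_mono) (auto simp: y_def)
    also have "\<dots> \<le> cmod D * (t * cmod v)" using D t v by (intro mult_right_mono) auto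
    also have "\<dots> = t * cmod E" using \<open>D \<noteq> 0\<close> by (simp add: v_def norm_divide)
    finally have "k * (y ^ n - (1 - cmod (z - a)) ^ n) \<le> k * (t * cmod E)"
      using k0 by (intro mult_left_mono) auto
    hence "F z - F w \<le> (1 - t) * cmod E + t * ((1 - k) * cmod E / 2) - cmod E + k * (t * cmod E)"
      using 1 by (simp add: F_def E_def y_def algebra_simps)
    also have "\<dots> = - (t * (1 - k) * cmod E / 2)" by (simp add: field_simps)
    also have "\<dots> < 0" using t k E by simp
    finally show False using min[OF zr] by simp
  qed
  with w show ?thesis by blast
qed

text \<open>For every slightly larger radius the inequality is strict and the previous lemma yields a preimage
  of \<open>c\<close>. One of these already lies in the smaller disc, as \<open>p\<close> takes the value \<open>c\<close> only
  finitely often.\<close>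

lemma preimage_in_cball:
  fixes p :: "complex poly" and a c :: complex
  assumes p': "\<And>z. cmod (z - a) < 1 \<Longrightarrow> of_nat n * (1 - cmod (z - a)) ^ (n - 1) \<le> cmod (poly (pderiv p) z)"
    and n: "n > 0" and r: "0 \<le> r" "r < 1" and c: "cmod (poly p a - c) \<le> 1 - (1 - r) ^ n"
  shows "\<exists>z. cmod (z - a) \<le> r \<and> poly p z = c"
proof (rule ccontr)
  assume none: "\<not> ?thesis"
  define Z where "Z = {z. poly (p - [:c:]) z = 0}"
  have "pderiv p \<noteq> 0" using p'[of a] n by auto
  hence "p - [:c:] \<noteq> 0" by auto
  hence "finite Z" unfolding Z_def by (rule poly_roots_finite)
  define s where "s = Min (insert 1 ((\<lambda>z. cmod (z - a)) ` Z))"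
  have "r < s" using none r \<open>finite Z\<close> unfolding s_def by (subst Min_gr_iff) (auto simp: Z_def not_le)
  then obtain r' where r': "r < r'" "r' < s" using dense by blast
  have "s \<le> 1" unfolding s_def using \<open>finite Z\<close> by (intro Min_le) auto
  hence "(1 - r') ^ n < (1 - r) ^ n" using r' n by (intro power_strict_mono) auto
  hence "cmod (poly p a - c) < 1 - (1 - r') ^ n" using c by simp
  with preimage_in_ball[OF p' n, of r' c] r r' \<open>s \<le> 1\<close>
  obtain z where z: "cmod (z - a) \<le> r'" "poly p z = c" by auto
  hence "s \<le> cmod (z - a)" unfolding s_def using \<open>finite Z\<close> by (intro Min_le) (auto simp: Z_def)
  with z r' show False by simp
qed

section \<open>A critical point with large real part\<close>

theorem mainTheorem1:
  fixes n :: nat and a lam :: real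
    and z \<zeta> :: "nat \<Rightarrow> complex" and \<rho> :: "nat \<Rightarrow> real"
    and p :: "complex poly"
  assumes "n \<ge> 2" and "0 < a" and "a < 1"
    and "\<And>k. k \<in> {1..n - 1} \<Longrightarrow> cmod (z k) \<le> 1"
    and "p = [:- complex_of_real a, 1:] * (\<Prod>k = 1..n - 1. [:- z k, 1:])"
    and "pderiv p = smult (of_nat n) (\<Prod>j = 1..n - 1. [:- \<zeta> j, 1:])"
    and "\<And>j. j \<in> {1..n - 1} \<Longrightarrow> \<rho> j = cmod (complex_of_real a - \<zeta> j)"
    and "\<And>i j. 1 \<le> i \<Longrightarrow> i \<le> j \<Longrightarrow> j \<le> n - 1 \<Longrightarrow> \<rho> i \<le> \<rho> j"
    and "1 - (1 - cmod (poly p 0)) powr (1 / real n) \<le> lam"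
    and "lam \<le> sin (pi / real n)"
    and "lam < a"
    and "\<rho> 1 \<ge> 1"
  shows "\<exists>\<zeta>\<^sub>0 \<in> \<zeta> ` {1..n - 1}. \<exists>\<rho>\<^sub>0 \<theta>\<^sub>0 :: real.
           \<zeta>\<^sub>0 = complex_of_real a + complex_of_real \<rho>\<^sub>0 * exp (\<i> * complex_of_real \<theta>\<^sub>0)
           \<and> \<rho>\<^sub>0 = cmod (\<zeta>\<^sub>0 - complex_of_real a)
           \<and> Re \<zeta>\<^sub>0 \<ge> (1 / 2) * (a - lam * (lam + 2) / a)"
proof -
  note p = assms(5) and p' = assms(6)
  have pa: "poly p (of_real a) = 0" by (simp add: p)
  have p0: "cmod (poly p 0) \<le> a"
  proof -
    have "(\<Prod>k = 1..n - 1. cmod (z k)) \<le> 1" using assms(4) by (intro prod_le_1) auto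
    thus ?thesis using assms(2) mult_left_mono[of _ 1 a]
      by (simp add: p poly_prod norm_mult prod_norm[symmetric])
  qed
  have p0_lam: "cmod (poly p 0) \<le> 1 - (1 - lam) ^ n"
  proof -
    have "(1 - lam) ^ n \<le> ((1 - cmod (poly p 0)) powr (1 / real n)) ^ n"
      using assms by (intro power_mono) auto
    also have "\<dots> = 1 - cmod (poly p 0)"
      using assms p0 by (simp add: powr_power)
    finally show ?thesis by simp
  qed
  have lam: "0 \<le> lam"
  proof -
    have "(1 - cmod (poly p 0)) powr (1 / real n) \<le> 1" using p0 assms by (intro powr_le1) auto
    thus ?thesis using assms(9) by linarith
  qed
  have crit_far: "1 \<le> cmod (of_real a - \<zeta> j)" if "j \<in> {1..n - 1}" for j
    using assms(7)[OF that] assms(8)[of 1 j] assms(12) that by auto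
  have "\<exists>w. cmod (w - of_real a) \<le> lam \<and> poly p w = poly p 0"
  proof (rule preimage_in_cball)
    fix u :: complex assume u: "cmod (u - of_real a) < 1"
    have "(\<Prod>j = 1..n - 1. 1 - cmod (u - of_real a)) \<le> (\<Prod>j = 1..n - 1. cmod (u - \<zeta> j))"
    proof (rule prod_mono, safe)
      fix j assume "j \<in> {1..n - 1}"
      have "cmod (of_real a - \<zeta> j) \<le> cmod (u - \<zeta> j) + cmod (u - of_real a)"
        using norm_triangle_ineq4[of "u - \<zeta> j" "u - of_real a"] by simp
      thus "1 - cmod (u - of_real a) \<le> cmod (u - \<zeta> j)" using crit_far[OF \<open>j \<in> _\<close>] by simp
    qed (use u in simp)
    thus "of_nat n * (1 - cmod (u - of_real a)) ^ (n - 1) \<le> cmod (poly (pderiv p) u)"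
      by (simp add: p' poly_prod norm_mult prod_norm[symmetric] mult_left_mono)
  qed (use assms lam p0_lam pa in auto)
  then obtain w where w: "cmod (w - of_real a) \<le> lam" "poly p w = poly p 0" by blast
  have "w \<noteq> 0" using w assms by auto
  with critical_point_bisector[OF _ p', of 0 w] w assms(1)
  obtain j where j: "j \<in> {1..n - 1}" "cmod (\<zeta> j - w) \<le> cmod (\<zeta> j)" by auto
  have unit: "cmod (\<zeta> j) \<le> 1"
  proof (rule gauss_lucas_unit_disc)
    \<comment> \<open>index \<open>0\<close> is free to carry the zero \<open>a\<close> of \<open>p\<close>\<close>
    let ?r = "z(0 := of_real a)"
    have "(\<Prod>i\<in>insert 0 {1..n - 1}. [:- ?r i, 1:]) = [:- of_real a, 1:] * (\<Prod>i = 1..n - 1. [:- z i, 1:])"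
      by (subst prod.insert) (auto intro!: prod.cong arg_cong2[of _ _ _ _ times])
    hence "(\<Prod>i\<in>insert 0 {1..n - 1}. [:- ?r i, 1:]) = p" by (simp only: p)
    moreover have "poly (pderiv p) (\<zeta> j) = 0" using j by (auto simp: p' poly_prod)
    ultimately show "poly (pderiv (\<Prod>i\<in>insert 0 {1..n - 1}. [:- ?r i, 1:])) (\<zeta> j) = 0" by simp
    show "cmod (?r i) \<le> 1" if "i \<in> insert 0 {1..n - 1}" for i using that assms by auto
  qed auto
  have "cmod (\<zeta> j - of_real a) \<le> cmod (\<zeta> j) + lam"
    using norm_triangle_ineq[of "\<zeta> j - w" "w - of_real a"] j w by simp
  hence "(cmod (\<zeta> j - of_real a))\<^sup>2 \<le> (cmod (\<zeta> j) + lam)\<^sup>2" by (intro power_mono) auto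
  also have "\<dots> \<le> (cmod (\<zeta> j))\<^sup>2 + lam * (lam + 2)"
    using mult_left_mono[OF unit lam] by (simp add: power2_eq_square algebra_simps)
  finally have "a\<^sup>2 - lam * (lam + 2) \<le> 2 * a * Re (\<zeta> j)"
    unfolding cmod_power2 by (simp add: power2_eq_square algebra_simps)
  hence Re: "Re (\<zeta> j) \<ge> (1 / 2) * (a - lam * (lam + 2) / a)"
    using assms(2) by (simp add: field_simps power2_eq_square)
  have "\<zeta> j = of_real a + of_real (cmod (\<zeta> j - of_real a)) * exp (\<i> * of_real (Arg (\<zeta> j - of_real a)))"
    using Arg_eq[of "\<zeta> j - of_real a"] by (cases "\<zeta> j = of_real a") (auto simp: algebra_simps)
  with Re j show ?thesis by (intro bexI[of _ "\<zeta> j"] exI conjI) auto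
qed

end
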